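(* Let $(X,d)$ be a compact metric space, let $\phi$ be a regular continuous flow on $X$ and let $x_1\in X$. If $\phi$ is expansive on $X\setminus\mathrm{orb}(x_1)$, then $\phi$ is expansive on $X$.
   Context: A continuous flow on $X$ is a continuous map $\phi\colon\mathbb{R}\times X\to X$, $\phi_t=\phi(t,\cdot)$, with $\phi_0=\mathrm{id}$ and $\phi_{t+s}=\phi_s\circ\phi_t$; it is regular if it has no fixed points. $\mathrm{orb}(x)=\{\phi_t(x):t\in\mathbb{R}\}$. Let $Rep$ be the set of increasing homeomorphisms $h\colon\mathbb{R}\to\mathbb{R}$ with $h(0)=0$. For a subset $Y\subset X$, $\phi$ is expansive on $Y$ if for every $\varepsilon>0$ there is $\delta>0$ such that whenever $x,y\in Y$ and $h\in Rep$ satisfy $d(\phi_t(x),\phi_{h(t)}(y))\le\delta$ for all $t\in\mathbb{R}$, then $y\in\phi_{[-\varepsilon,\varepsilon]}(x)$. Expansive on $X$ is this condition with $Y=X$. *)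

theory Defs
  imports "HOL-Analysis.Analysis"
begin

definition continuous_flow :: "(real \<Rightarrow> 'a::metric_space \<Rightarrow> 'a) \<Rightarrow> bool" where
  "continuous_flow phi \<longleftrightarrow>
     continuous_on UNIV (\<lambda>(t, x). phi t x) \<and>
     phi 0 = id \<and>
     (\<forall>t s. phi (t + s) = phi s \<circ> phi t)"

definition regular_flow :: "(real \<Rightarrow> 'a::metric_space \<Rightarrow> 'a) \<Rightarrow> bool" where
  "regular_flow phi \<longleftrightarrow> continuous_flow phi \<and> \<not> (\<exists>x. \<forall>t. phi t x = x)"

definition orb :: "(real \<Rightarrow> 'a \<Rightarrow> 'a) \<Rightarrow> 'a \<Rightarrow> 'a set" where
  "orb phi x = {phi t x | t. t \<in> (UNIV :: real set)}"

definition Rep :: "(real \<Rightarrow> real) set" where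
  "Rep = {h. homeomorphism UNIV UNIV h (inv h) \<and> strict_mono h \<and> h 0 = 0}"

definition expansive_on :: "(real \<Rightarrow> 'a::metric_space \<Rightarrow> 'a) \<Rightarrow> 'a set \<Rightarrow> bool" where
  "expansive_on phi Y \<longleftrightarrow>
     (\<forall>\<epsilon>>0. \<exists>\<delta>>0. \<forall>x\<in>Y. \<forall>y\<in>Y. \<forall>h\<in>Rep.
        (\<forall>t. dist (phi t x) (phi (h t) y) \<le> \<delta>) \<longrightarrow>
        y \<in> (\<lambda>s. phi s x) ` {-\<epsilon>..\<epsilon>})"

end

theory Submission
  imports Defs "HOL-Complex_Analysis.Great_Picard"
begin

text \<open>
  Say that \<open>y\<close> \<open>\<delta>\<close>-shadows \<open>x\<close> if the orbit of \<open>y\<close>, suitably reparametrized, stays within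
  \<open>\<delta>\<close> of that of \<open>x\<close>. Two points shadowing \<open>x1\<close> shadow each other, so expansiveness off the orbit
  of \<open>x1\<close> forces every point shadowing \<open>x1\<close> closely enough to lie on that orbit. This leaves
  pairs on the orbit of \<open>x1\<close>; a periodic orbit is handled by compactness. If the orbit is not
  periodic and expansiveness fails on it, then each of its points is shadowed arbitrarily closely
  by points of the orbit at arbitrarily distant times. The closure of the set of points shadowing
  \<open>x1\<close> with a constant less than \<open>\<delta>\<close> still consists of points shadowing \<open>x1\<close>, so it is a compact
  subset of the orbit, that is, a countable union of compact pieces of orbit arcs. By the
  preceding recurrence none of these has interior in it, contradicting Baire's theorem.
\<close>

section \<open>Increasing reparametrizations of the real line\<close>

text \<open>A monotone map with open range is continuous; this applies to \<open>h\<close> because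
  it is onto and to \<open>inv h\<close> because \<open>h\<close> is injective. Membership in
  \<open>Rep\<close> can then be checked without topology.\<close>

lemma Rep_iff: "h \<in> Rep \<longleftrightarrow> strict_mono h \<and> surj h \<and> h 0 = 0"
proof
  assume "h \<in> Rep"
  then show "strict_mono h \<and> surj h \<and> h 0 = 0"
    by (auto simp: Rep_def homeomorphism_def)
next
  assume h: "strict_mono h \<and> surj h \<and> h 0 = 0"
  then have inj: "inj h" and mono: "mono h"
    by (auto simp: strict_mono_imp_inj_on strict_mono_mono)
  have "continuous_on UNIV h"
    by (rule continuous_onI_mono) (use h mono in \<open>auto simp: monoD\<close>)
  moreover have "continuous_on UNIV (inv h)"
  proof (rule continuous_onI_mono)
    show "open (range (inv h))"
      using inj by (simp add: inj_imp_surj_inv)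
    show "inv h x \<le> inv h y" if "x \<le> y" for x y
      using that h strict_mono_less_eq[of h "inv h x" "inv h y"] by (simp add: surj_f_inv_f)
  qed
  ultimately show "h \<in> Rep"
    using h inj by (auto simp: Rep_def homeomorphism_def surj_f_inv_f inj_imp_surj_inv)
qed

lemma Rep_continuous: "h \<in> Rep \<Longrightarrow> continuous_on A h"
  by (auto simp: Rep_def homeomorphism_def intro: continuous_on_subset)

lemma Rep_inv:
  assumes "h \<in> Rep"
  shows "inv h \<in> Rep"
proof -
  have h: "strict_mono h" "surj h" "h 0 = 0" and inj: "inj h"
    using assms by (auto simp: Rep_iff strict_mono_imp_inj_on)
  have "inv h x < inv h y" if "x < y" for x y
    using that h strict_mono_less[OF h(1), of "inv h x" "inv h y"] by (simp add: surj_f_inv_f)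
  then show ?thesis
    using inj h(3) inv_f_f[OF inj, of 0] by (auto simp: Rep_iff strict_mono_def inj_imp_surj_inv)
qed

lemma Rep_comp:
  assumes "h \<in> Rep" "g \<in> Rep"
  shows "(\<lambda>t. g (h t)) \<in> Rep"
  using assms comp_surj[of h g] unfolding Rep_iff by (auto simp: strict_mono_def o_def)

lemma Rep_shift:
  assumes "h \<in> Rep"
  shows "(\<lambda>t. h (t + r) - h r) \<in> Rep"
proof -
  have "surj (\<lambda>t. h (t + r) - h r)"
  proof (rule surjI)
    fix y
    show "h ((inv h (y + h r) - r) + r) - h r = y"
      using assms by (simp add: Rep_iff surj_f_inv_f)
  qed
  then show ?thesis
    using assms by (auto simp: Rep_iff strict_mono_def)
qed

text \<open>Joining the points \<open>(j * T, a j)\<close> linearly works: the gap \<open>c\<close>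
  makes the interpolant strictly increasing and unbounded in both directions. This rebuilds a
  reparametrization from values prescribed at the times \<open>j * T\<close>.\<close>

lemma Rep_interpolation:
  fixes a :: "int \<Rightarrow> real"
  assumes "T > 0" "c > 0" and a0: "a 0 = 0" and inc: "\<And>j. c \<le> a (j + 1) - a j"
  obtains g where "g \<in> Rep"
    "\<And>t. a \<lfloor>t / T\<rfloor> \<le> g t" "\<And>t. g t \<le> a (\<lfloor>t / T\<rfloor> + 1)"
proof -
  define g where "g t = a \<lfloor>t / T\<rfloor> + frac (t / T) * (a (\<lfloor>t / T\<rfloor> + 1) - a \<lfloor>t / T\<rfloor>)" for t
  have pos: "0 < a (j + 1) - a j" for j using inc[of j] assms by linarith
  have grow: "a j + c * real k \<le> a (j + int k)" for j k
  proof (induction k)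
    case (Suc k)
    then show ?case using inc[of "j + int k"] by (simp add: algebra_simps)
  qed simp
  have mono: "a i \<le> a j" if "i \<le> j" for i j
  proof -
    have "0 \<le> c * real (nat (j - i))" using assms by simp
    then show ?thesis using grow[of i "nat (j - i)"] that by simp
  qed
  have lower: "a \<lfloor>t / T\<rfloor> \<le> g t" for t
    unfolding g_def using pos[of "\<lfloor>t / T\<rfloor>"] by simp
  have upper: "g t < a (\<lfloor>t / T\<rfloor> + 1)" for t
  proof -
    have "frac (t / T) * (a (\<lfloor>t / T\<rfloor> + 1) - a \<lfloor>t / T\<rfloor>) < 1 * (a (\<lfloor>t / T\<rfloor> + 1) - a \<lfloor>t / T\<rfloor>)"
      using pos[of "\<lfloor>t / T\<rfloor>"] frac_lt_1 by (intro mult_strict_right_mono) auto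
    then show ?thesis unfolding g_def by simp
  qed
  have "strict_mono g"
  proof (rule strict_monoI)
    fix t u :: real
    assume "t < u"
    then have tu: "t / T < u / T" using assms by (simp add: divide_strict_right_mono)
    then have "\<lfloor>t / T\<rfloor> \<le> \<lfloor>u / T\<rfloor>" by (intro floor_mono) simp
    then consider "\<lfloor>t / T\<rfloor> = \<lfloor>u / T\<rfloor>" | "\<lfloor>t / T\<rfloor> + 1 \<le> \<lfloor>u / T\<rfloor>" by linarith
    then show "g t < g u"
    proof cases
      case 1
      then have "frac (t / T) < frac (u / T)" using tu by (simp add: frac_def)
      then show ?thesis using 1 pos[of "\<lfloor>u / T\<rfloor>"] by (simp add: g_def)
    next
      case 2
      then show ?thesis using upper[of t] lower[of u] mono[OF 2] by linarith
    qed
  qed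
  moreover have "surj g"
  proof -
    have "\<exists>x. g x = v" for v
    proof -
      obtain k :: nat where k: "\<bar>v\<bar> < c * real k"
        using reals_Archimedean3[OF \<open>c > 0\<close>] by (metis mult.commute)
      \<comment> \<open>Indices are counted from \<open>- int k\<close>, so the segment containing
        \<open>v\<close> is found by a least-number search over the naturals.\<close>
      have "v < a (- int k + int (2 * k))" "\<not> v < a (- int k + int 0)"
        using grow[of 0 k] grow[of "- int k" k] a0 k by (auto simp: abs_less_iff)
      then obtain n where n: "\<And>i. i \<le> n \<Longrightarrow> \<not> v < a (- int k + int i)" "v < a (- int k + int (Suc n))"
        using ex_least_nat_less[of "\<lambda>n. v < a (- int k + int n)" "2 * k"] by auto
      define j where "j = - int k + int n"
      have j: "a j \<le> v" "v < a (j + 1)"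
        using n(1)[of n] n(2) by (simp_all add: j_def algebra_simps)
      define f where "f = (v - a j) / (a (j + 1) - a j)"
      have f: "0 \<le> f" "f < 1" "f * (a (j + 1) - a j) = v - a j"
        using j by (auto simp: f_def)
      have quot: "T * (of_int j + f) / T = of_int j + f" using assms by simp
      have "\<lfloor>of_int j + f\<rfloor> = j" using f by linarith
      then have "g (T * (of_int j + f)) = v"
        using f(3) by (simp add: g_def quot frac_def)
      then show ?thesis by blast
    qed
    then show ?thesis by (metis surjI)
  qed
  moreover have "g 0 = 0" by (simp add: g_def a0)
  ultimately show ?thesis
    using lower upper by (intro that[of g]) (auto simp: Rep_iff intro: less_imp_le)
qed

section \<open>The shadowing relation\<close>

text \<open>Quantifying \<open>h\<close> away leaves a relation that behaves like a distance bound: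
  inverting \<open>h\<close> gives symmetry, composing gives a triangle inequality.\<close>

definition shadows :: "(real \<Rightarrow> 'a::metric_space \<Rightarrow> 'a) \<Rightarrow> real \<Rightarrow> 'a \<Rightarrow> 'a \<Rightarrow> bool" where
  "shadows phi \<delta> x y \<longleftrightarrow> (\<exists>h\<in>Rep. \<forall>t. dist (phi t x) (phi (h t) y) \<le> \<delta>)"

lemma expansive_on_iff_shadows:
  "expansive_on phi Y \<longleftrightarrow>
     (\<forall>\<epsilon>>0. \<exists>\<delta>>0. \<forall>x\<in>Y. \<forall>y\<in>Y. shadows phi \<delta> x y \<longrightarrow> y \<in> (\<lambda>s. phi s x) ` {-\<epsilon>..\<epsilon>})"
proof -
  have "(\<forall>h\<in>Rep. (\<forall>t. dist (phi t x) (phi (h t) y) \<le> \<delta>) \<longrightarrow> P) \<longleftrightarrow> (shadows phi \<delta> x y \<longrightarrow> P)"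
    for x y \<delta> P
    unfolding shadows_def by (rule iffI; blast)
  then show ?thesis
    unfolding expansive_on_def by (simp only:)
qed

lemma shadows_mono:
  assumes "shadows phi \<delta> x y" "\<delta> \<le> \<delta>'"
  shows "shadows phi \<delta>' x y"
proof -
  from assms obtain h where "h \<in> Rep" "\<forall>t. dist (phi t x) (phi (h t) y) \<le> \<delta>"
    by (auto simp: shadows_def)
  moreover from this assms(2) have "\<forall>t. dist (phi t x) (phi (h t) y) \<le> \<delta>'"
    using order_trans by blast
  ultimately show ?thesis by (auto simp: shadows_def)
qed

lemma shadows_sym:
  assumes "shadows phi \<delta> x y"
  shows "shadows phi \<delta> y x"
proof -
  from assms obtain h where h: "h \<in> Rep" "\<And>t. dist (phi t x) (phi (h t) y) \<le> \<delta>"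
    by (auto simp: shadows_def)
  have "dist (phi t y) (phi (inv h t) x) \<le> \<delta>" for t
    using h(2)[of "inv h t"] h(1) by (simp add: Rep_iff surj_f_inv_f dist_commute)
  then show ?thesis
    unfolding shadows_def by (intro bexI[OF _ Rep_inv[OF h(1)]]) simp
qed

lemma shadows_trans:
  assumes "shadows phi \<delta> x y" "shadows phi \<delta>' y z"
  shows "shadows phi (\<delta> + \<delta>') x z"
proof -
  from assms obtain h g where h: "h \<in> Rep" "\<And>t. dist (phi t x) (phi (h t) y) \<le> \<delta>"
    and g: "g \<in> Rep" "\<And>t. dist (phi t y) (phi (g t) z) \<le> \<delta>'"
    by (auto simp: shadows_def)
  have "dist (phi t x) (phi (g (h t)) z) \<le> \<delta> + \<delta>'" for t
    using h(2)[of t] g(2)[of "h t"] dist_triangle[of "phi t x" "phi (g (h t)) z" "phi (h t) y"]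
    by linarith
  then show ?thesis
    unfolding shadows_def by (intro bexI[OF _ Rep_comp[OF h(1) g(1)]]) simp
qed

section \<open>Short times and short periods of a regular flow on a compact space\<close>

locale compact_regular_flow =
  fixes phi :: "real \<Rightarrow> 'a::metric_space \<Rightarrow> 'a"
  assumes compact_space: "compact (UNIV :: 'a set)"
    and regular: "regular_flow phi"
begin

lemma flow_0 [simp]: "phi 0 x = x"
  and flow_flow [simp]: "phi s (phi t x) = phi (t + s) x"
  and flow_continuous: "continuous_on UNIV (\<lambda>(t, x). phi t x)"
  using regular by (simp_all add: regular_flow_def continuous_flow_def)

lemma no_fixed_point: "\<exists>t. phi t x \<noteq> x"
  using regular by (simp add: regular_flow_def)

lemma flow_continuous_on [continuous_intros]:
  assumes "continuous_on A f" "continuous_on A g"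
  shows "continuous_on A (\<lambda>u. phi (f u) (g u))"
proof -
  have "continuous_on A ((\<lambda>(t, x). phi t x) \<circ> (\<lambda>u. (f u, g u)))"
    by (intro continuous_on_compose continuous_on_Pair assms continuous_on_subset[OF flow_continuous]) auto
  then show ?thesis by (simp add: o_def)
qed

lemma flow_tendsto [tendsto_intros]:
  assumes "(f \<longlongrightarrow> a) F" "(g \<longlongrightarrow> b) F"
  shows "((\<lambda>u. phi (f u) (g u)) \<longlongrightarrow> phi a b) F"
proof -
  have "isCont (\<lambda>(t, x). phi t x) (a, b)"
    using flow_continuous by (simp add: continuous_on_eq_continuous_at)
  from isCont_tendsto_compose[OF this tendsto_Pair[OF assms]] show ?thesis by simp
qed

lemma subseq_limit:
  fixes z :: "nat \<Rightarrow> 'a"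
  obtains l r where "strict_mono (r :: nat \<Rightarrow> nat)" "(z \<circ> r) \<longlonglongrightarrow> l"
  using compact_imp_seq_compact[OF compact_space] unfolding seq_compact_def by blast

text \<open>Restarting at time \<open>r\<close> turns \<open>h\<close> into
  \<open>h (t + r) - h r\<close>, which again fixes 0; base points can thus slide along their
  orbits.\<close>

lemma shadows_flow:
  assumes "h \<in> Rep" "\<And>t. dist (phi t x) (phi (h t) y) \<le> \<delta>"
  shows "shadows phi \<delta> (phi r x) (phi (h r) y)"
  unfolding shadows_def
proof (intro bexI allI)
  show "(\<lambda>t. h (t + r) - h r) \<in> Rep" by (rule Rep_shift[OF assms(1)])
  show "dist (phi t (phi r x)) (phi (h (t + r) - h r) (phi (h r) y)) \<le> \<delta>" for t
    using assms(2)[of "t + r"] by (simp add: add.commute)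
qed

text \<open>Uniform continuity of the flow on the compact set \<open>{-1..1} \<times> UNIV\<close>
  makes \<open>c\<close> independent of \<open>z\<close>.\<close>

lemma small_times_move_little:
  assumes "\<eta> > 0"
  obtains c where "c > 0" "\<And>z s. \<bar>s\<bar> \<le> c \<Longrightarrow> dist (phi s z) z < \<eta>"
proof -
  have "compact ({-1..1::real} \<times> (UNIV :: 'a set))"
    by (intro compact_Times compact_space) auto
  then have "uniformly_continuous_on ({-1..1} \<times> UNIV) (\<lambda>(t, x). phi t x)"
    by (intro compact_uniformly_continuous continuous_on_subset[OF flow_continuous]) auto
  then obtain d where d: "d > 0" and *:
    "\<And>p q. p \<in> {-1..1} \<times> UNIV \<Longrightarrow> q \<in> {-1..1} \<times> UNIV \<Longrightarrow> dist q p < d \<Longrightarrow>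
      dist ((\<lambda>(t, x). phi t x) q) ((\<lambda>(t, x). phi t x) p) < \<eta>"
    using assms unfolding uniformly_continuous_on_def by blast
  show ?thesis
  proof (rule that[of "min 1 (d/2)"])
    fix z s assume s: "\<bar>s\<bar> \<le> min 1 (d/2)"
    then show "dist (phi s z) z < \<eta>"
      using *[of "(0, z)" "(s, z)"] d by (auto simp: dist_Pair_Pair dist_real_def abs_le_iff)
  qed (use d in auto)
qed

lemma period_multiple:
  assumes "phi s z = z"
  shows "phi (of_int k * s) z = z"
proof -
  have nat: "phi (real n * s) z = z" for n
  proof (induction n)
    case (Suc n)
    have "phi s (phi (real n * s) z) = z" using Suc assms by simp
    then show ?case by (simp add: algebra_simps)
  qed simp
  show ?thesis
  proof (cases "k \<ge> 0")
    case True
    then show ?thesis using nat[of "nat k"] by simp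
  next
    case False
    have "phi (of_int k * s) (phi (real (nat (-k)) * s) z) = phi (of_int k * s) z"
      using nat[of "nat (-k)"] by simp
    then show ?thesis using False by simp
  qed
qed

lemma reduce_mod_period:
  assumes "s > 0" "phi s z = z"
  obtains q where "0 \<le> q" "q \<le> s" "phi q z = phi t z"
proof
  define q where "q = t - of_int \<lfloor>t / s\<rfloor> * s"
  have "of_int \<lfloor>t / s\<rfloor> * s \<le> (t / s) * s" "(t / s) * s \<le> (of_int \<lfloor>t / s\<rfloor> + 1) * s"
    using assms by (intro mult_right_mono; linarith)+
  then show "0 \<le> q" "q \<le> s"
    using assms by (auto simp: q_def algebra_simps)
  have "phi q (phi (of_int \<lfloor>t / s\<rfloor> * s) z) = phi t z"
    by (simp add: q_def)
  then show "phi q z = phi t z" by (simp only: period_multiple[OF assms(2)])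
qed

text \<open>Points with periods tending to 0 would accumulate at some \<open>l\<close>. Any time
  \<open>t\<close> reduces modulo these periods to times tending to 0, so \<open>phi t l = l\<close>
  for every \<open>t\<close>, against regularity.\<close>

lemma no_short_periods:
  obtains T0 where "T0 > 0" "\<And>s z. 0 < s \<Longrightarrow> s \<le> T0 \<Longrightarrow> phi s z \<noteq> z"
proof (rule ccontr)
  assume "\<not> thesis"
  then have "\<exists>s z. 0 < s \<and> s \<le> 1 / Suc n \<and> phi s z = z" for n
    using that[of "1 / Suc n"] by auto
  then obtain s z where s: "\<And>n. 0 < s n" "\<And>n. s n \<le> 1 / Suc n" and z: "\<And>n. phi (s n) (z n) = z n"
    by metis
  obtain l r where r: "strict_mono (r :: nat \<Rightarrow> nat)" and l: "(z \<circ> r) \<longlonglongrightarrow> l"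
    using subseq_limit .
  have s0: "s \<longlonglongrightarrow> 0"
  proof (rule tendsto_sandwich[OF _ _ tendsto_const])
    show "(\<lambda>n. 1 / real (Suc n)) \<longlonglongrightarrow> 0" using lim_1_over_n LIMSEQ_Suc by blast
  qed (use s in \<open>auto intro!: always_eventually less_imp_le\<close>)
  have "phi t l = l" for t
  proof -
    have "\<exists>q. 0 \<le> q \<and> q \<le> s n \<and> phi q (z n) = phi t (z n)" for n
      using reduce_mod_period[OF s(1) z] by metis
    then obtain q where q: "\<And>n. 0 \<le> q n" "\<And>n. q n \<le> s n" "\<And>n. phi (q n) (z n) = phi t (z n)"
      by metis
    have "q \<longlonglongrightarrow> 0"
      by (rule tendsto_sandwich[OF _ _ tendsto_const s0]) (use q in auto)
    then have "(q \<circ> r) \<longlonglongrightarrow> 0" using r by (rule LIMSEQ_subseq_LIMSEQ)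
    then have "(\<lambda>n. phi ((q \<circ> r) n) ((z \<circ> r) n)) \<longlonglongrightarrow> phi 0 l" using l by (intro tendsto_intros)
    then have "(\<lambda>n. phi t ((z \<circ> r) n)) \<longlonglongrightarrow> l" using q by simp
    moreover have "(\<lambda>n. phi t ((z \<circ> r) n)) \<longlonglongrightarrow> phi t l" using l by (intro tendsto_intros)
    ultimately show ?thesis using LIMSEQ_unique by blast
  qed
  then show False using no_fixed_point by blast
qed

text \<open>The displacement under \<open>phi s\<close> attains its minimum by compactness; a zero
  minimum would yield a point of period \<open>\<bar>s\<bar>\<close>, too short to exist.\<close>

lemma short_times_move:
  obtains T0 where "T0 > 0" "\<And>s. s \<noteq> 0 \<Longrightarrow> \<bar>s\<bar> \<le> T0 \<Longrightarrow> \<exists>\<gamma>>0. \<forall>z. \<gamma> \<le> dist (phi s z) z"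
proof -
  obtain T0 where T0: "T0 > 0" "\<And>s z. 0 < s \<Longrightarrow> s \<le> T0 \<Longrightarrow> phi s z \<noteq> z"
    using no_short_periods by blast
  show ?thesis
  proof (rule that[OF T0(1)])
    fix s :: real
    assume s: "s \<noteq> 0" "\<bar>s\<bar> \<le> T0"
    have "continuous_on UNIV (\<lambda>z. dist (phi s z) z)" by (intro continuous_intros)
    then obtain z0 where z0: "\<And>z. dist (phi s z0) z0 \<le> dist (phi s z) z"
      using continuous_attains_inf[OF compact_space UNIV_not_empty, of "\<lambda>z. dist (phi s z) z"] by auto
    have "phi s z0 \<noteq> z0"
    proof
      assume "phi s z0 = z0"
      moreover from arg_cong[OF this, of "phi (-s)"] have "phi (-s) z0 = z0" by simp
      ultimately have "phi \<bar>s\<bar> z0 = z0" by (simp add: abs_if)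
      then show False using T0(2)[of "\<bar>s\<bar>"] s by simp
    qed
    with z0 show "\<exists>\<gamma>>0. \<forall>z. \<gamma> \<le> dist (phi s z) z"
      by (intro exI[of _ "dist (phi s z0) z0"]) auto
  qed
qed

section \<open>Bounds on reparametrizations and limits of shadowing points\<close>

text \<open>In time \<open>T\<close> the point on the orbit of \<open>x\<close> moves by a definite
  amount, so \<open>h\<close> cannot advance too little; but it moves less than any point does in
  time \<open>C\<close>, so \<open>h\<close> cannot advance too much. The constants are chosen in
  the order \<open>C\<close>, \<open>T\<close>, \<open>c\<close>, \<open>\<delta>\<close>.\<close>

lemma Rep_increments_of_shadowing:
  assumes "\<eta> > 0"
  obtains T C c \<delta> where "0 < T" "0 < c" "0 < \<delta>" "\<delta> \<le> \<eta>"
    and "\<forall>s z. 0 \<le> s \<longrightarrow> s \<le> T \<longrightarrow> dist (phi s z) z \<le> \<eta>"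
    and "\<forall>s z. 0 \<le> s \<longrightarrow> s \<le> C \<longrightarrow> dist (phi s z) z \<le> \<eta>"
    and "\<forall>x y. \<forall>h\<in>Rep. (\<forall>t. dist (phi t x) (phi (h t) y) \<le> \<delta>) \<longrightarrow>
           (\<forall>t. c \<le> h (t + T) - h t \<and> h (t + T) - h t \<le> C)"
proof -
  obtain T0 where T0: "T0 > 0" "\<And>s. s \<noteq> 0 \<Longrightarrow> \<bar>s\<bar> \<le> T0 \<Longrightarrow> \<exists>\<gamma>>0. \<forall>z. \<gamma> \<le> dist (phi s z) z"
    using short_times_move by blast
  obtain c0 where c0: "c0 > 0" "\<And>z s. \<bar>s\<bar> \<le> c0 \<Longrightarrow> dist (phi s z) z < \<eta>"
    using small_times_move_little[OF assms] by blast
  define C where "C = min c0 T0"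
  have C: "0 < C" "C \<le> c0" "C \<le> T0" using c0 T0 by (auto simp: C_def)
  obtain \<gamma> where \<gamma>: "\<gamma> > 0" "\<And>z. \<gamma> \<le> dist (phi C z) z" using T0(2)[of C] C by auto
  obtain c1 where c1: "c1 > 0" "\<And>z s. \<bar>s\<bar> \<le> c1 \<Longrightarrow> dist (phi s z) z < \<gamma> / 2"
    using small_times_move_little[of "\<gamma> / 2"] \<gamma> by auto
  define T where "T = min c1 C"
  have T: "0 < T" "T \<le> c1" "T \<le> C" using c1 C by (auto simp: T_def)
  obtain \<gamma>' where \<gamma>': "\<gamma>' > 0" "\<And>z. \<gamma>' \<le> dist (phi T z) z" using T0(2)[of T] C T by auto
  obtain c where c: "c > 0" "\<And>z s. \<bar>s\<bar> \<le> c \<Longrightarrow> dist (phi s z) z < \<gamma>' / 2"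
    using small_times_move_little[of "\<gamma>' / 2"] \<gamma>' by auto
  \<comment> \<open>Comparing displacements along the two orbits costs \<open>2 * \<delta>\<close>,
    one error per endpoint; the quarters keep this at half of \<open>\<gamma>\<close> and of
    \<open>\<gamma>'\<close>.\<close>
  define \<delta> where "\<delta> = min \<eta> (min (\<gamma> / 4) (\<gamma>' / 4))"
  have \<delta>: "0 < \<delta>" "\<delta> \<le> \<eta>" "\<delta> \<le> \<gamma> / 4" "\<delta> \<le> \<gamma>' / 4" using assms \<gamma> \<gamma>' by (auto simp: \<delta>_def)
  have "c \<le> h (t + T) - h t \<and> h (t + T) - h t \<le> C"
    if h: "h \<in> Rep" "\<And>t. dist (phi t x) (phi (h t) y) \<le> \<delta>" for x y h t
  proof (intro conjI; rule ccontr)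
    have mono: "a < b \<Longrightarrow> h a < h b" for a b
      using h(1) by (simp add: Rep_iff strict_mono_def)
    have lip: "dist (phi a x) (phi b x) \<le> 2 * \<delta> + dist (phi (h a) y) (phi (h b) y)"
      "dist (phi (h a) y) (phi (h b) y) \<le> 2 * \<delta> + dist (phi a x) (phi b x)" for a b
      using h(2)[of a] h(2)[of b] by metric+
    show False if "\<not> c \<le> h (t + T) - h t"
    proof -
      have "\<bar>h (t + T) - h t\<bar> \<le> c" using that mono[of t "t + T"] T by simp
      from c(2)[OF this, of "phi (h t) y"] have "dist (phi (h (t + T)) y) (phi (h t) y) < \<gamma>' / 2" by simp
      moreover have "\<gamma>' \<le> dist (phi (t + T) x) (phi t x)" using \<gamma>'(2)[of "phi t x"] by simp
      ultimately show False using lip(1)[of "t + T" t] \<delta> by linarith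
    qed
    show False if "\<not> h (t + T) - h t \<le> C"
    proof -
      \<comment> \<open>The lower bound \<open>\<gamma>\<close> is known only for time exactly
        \<open>C\<close>, so an intermediate time is chosen at which \<open>h\<close> has advanced
        by just that much.\<close>
      have "\<exists>u\<ge>t. u \<le> t + T \<and> h u = h t + C"
        using that C T by (intro IVT' Rep_continuous[OF h(1)]) auto
      then obtain u where u: "t \<le> u" "u \<le> t + T" "h u = h t + C" by blast
      have "\<gamma> \<le> dist (phi (h u) y) (phi (h t) y)" using \<gamma>(2)[of "phi (h t) y"] u by simp
      moreover have "dist (phi u x) (phi t x) < \<gamma> / 2" using c1(2)[of "u - t" "phi t x"] u T by simp
      ultimately show False using lip(2)[of u t] \<delta> by linarith
    qed
  qed
  then have "\<forall>x y. \<forall>h\<in>Rep. (\<forall>t. dist (phi t x) (phi (h t) y) \<le> \<delta>) \<longrightarrow>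
      (\<forall>t. c \<le> h (t + T) - h t \<and> h (t + T) - h t \<le> C)"
    by blast
  moreover have "dist (phi s z) z \<le> \<eta>" if "0 \<le> s" "s \<le> C" for s z
    using c0(2)[of s z] that C by simp
  moreover from this have "dist (phi s z) z \<le> \<eta>" if "0 \<le> s" "s \<le> T" for s z
    using that T by simp
  ultimately show ?thesis
    using that[of T c \<delta> C] T(1) c(1) \<delta>(1,2) by blast
qed

text \<open>Limits of the reparametrizations are taken only at the times \<open>j * T\<close>: their increments
  are bounded away from \<open>0\<close>, which a pointwise limit on the whole line would not guarantee.\<close>

lemma shadows_limit:
  assumes "\<eta> > 0"
  obtains \<delta> where "\<delta> > 0"
    "\<And>x y Y. (\<And>k::nat. shadows phi \<delta> x (Y k)) \<Longrightarrow> Y \<longlonglongrightarrow> y \<Longrightarrow> shadows phi \<eta> x y"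
proof -
  \<comment> \<open>Three errors will add up: from a time to its knot along \<open>x\<close>,
    between the orbits at the knot, and along \<open>y\<close>.\<close>
  have "\<eta> / 3 > 0" using assms by simp
  then obtain T C c \<delta> where pos: "0 < T" "0 < c" "0 < \<delta>" "\<delta> \<le> \<eta> / 3"
    and T: "\<forall>s z. 0 \<le> s \<longrightarrow> s \<le> T \<longrightarrow> dist (phi s z) z \<le> \<eta> / 3"
    and C: "\<forall>s z. 0 \<le> s \<longrightarrow> s \<le> C \<longrightarrow> dist (phi s z) z \<le> \<eta> / 3"
    and inc: "\<forall>x y. \<forall>h\<in>Rep. (\<forall>t. dist (phi t x) (phi (h t) y) \<le> \<delta>) \<longrightarrow>
           (\<forall>t. c \<le> h (t + T) - h t \<and> h (t + T) - h t \<le> C)"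
    by (rule Rep_increments_of_shadowing) (erule (6) that)
  have "shadows phi \<eta> x y" if Y: "\<And>k. shadows phi \<delta> x (Y k)" "Y \<longlonglongrightarrow> y" for x y and Y :: "nat \<Rightarrow> 'a"
  proof -
    have "\<forall>k. \<exists>h. h \<in> Rep \<and> (\<forall>t. dist (phi t x) (phi (h t) (Y k)) \<le> \<delta>)"
      using Y(1) unfolding shadows_def by blast
    then obtain h where h: "\<And>k. h k \<in> Rep" "\<And>k t. dist (phi t x) (phi (h k t) (Y k)) \<le> \<delta>"
      by metis
    define b where "b k j = h k (of_int j * T)" for k and j :: int
    have b_inc: "c \<le> b k (j + 1) - b k j" "b k (j + 1) - b k j \<le> C" for k j
      using inc[rule_format, OF h(1) h(2), of k "of_int j * T"] by (auto simp: b_def algebra_simps)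
    have b0: "b k 0 = 0" for k using h(1)[of k] by (simp add: b_def Rep_iff)
    have C0: "C \<ge> 0" using b_inc[of 0 0] pos by linarith
    have b_up: "\<bar>b k (int n)\<bar> \<le> C * real n \<and> \<bar>b k (- int n)\<bar> \<le> C * real n" for k n
    proof (induction n)
      case (Suc n)
      then show ?case
        using b_inc[of k "int n"] b_inc[of k "- 1 - int n"] pos
        by (simp add: algebra_simps abs_le_iff)
    qed (simp add: b0)
    have b_bound: "\<bar>b k j\<bar> \<le> C * \<bar>of_int j\<bar>" for k j
      using b_up[of k "nat \<bar>j\<bar>"] by (cases "j \<ge> 0") auto
    \<comment> \<open>The values \<open>b k j\<close> grow linearly in \<open>j\<close>. Dividing by
      \<open>1 + \<bar>of_int j\<bar>\<close> gives a bound uniform in \<open>j\<close>, as the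
      extraction of one subsequence for all \<open>j\<close> requires; \<open>a\<close> undoes the
      scaling.\<close>
    have b_norm: "norm (b k j / (1 + \<bar>of_int j\<bar>)) \<le> C" for k j
    proof -
      have "\<bar>b k j\<bar> \<le> C * (1 + \<bar>of_int j\<bar>)" using b_bound[of k j] C0 by (simp add: algebra_simps)
      then show ?thesis by (simp add: divide_le_eq)
    qed
    have "\<exists>r. strict_mono (r :: nat \<Rightarrow> nat) \<and>
        (\<forall>j. \<exists>l. (\<lambda>k. b (r k) j / (1 + \<bar>of_int j\<bar>)) \<longlonglongrightarrow> l)"
    proof (rule function_convergent_subsequence[of "UNIV :: int set" "\<lambda>k j. b k j / (1 + \<bar>of_int j\<bar>)" C])
      show "norm (b k j / (1 + \<bar>of_int j\<bar>)) \<le> C" for k j by (rule b_norm)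
    qed auto
    then obtain r where r: "strict_mono (r :: nat \<Rightarrow> nat)"
      "\<And>j. \<exists>l. (\<lambda>k. b (r k) j / (1 + \<bar>of_int j\<bar>)) \<longlonglongrightarrow> l" by blast
    then obtain l where l: "\<And>j. (\<lambda>k. b (r k) j / (1 + \<bar>of_int j\<bar>)) \<longlonglongrightarrow> l j" by metis
    define a where "a j = l j * (1 + \<bar>of_int j\<bar>)" for j
    have a: "(\<lambda>k. b (r k) j) \<longlonglongrightarrow> a j" for j
    proof -
      have "1 + \<bar>of_int j :: real\<bar> \<noteq> 0" by linarith
      then show ?thesis
        using tendsto_mult[OF l[of j] tendsto_const[of "1 + \<bar>of_int j\<bar>"]] by (simp add: a_def)
    qed
    have a0: "a 0 = 0" using LIMSEQ_unique[OF a[of 0]] by (simp add: b0)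
    have a_inc: "c \<le> a (j + 1) - a j" "a (j + 1) - a j \<le> C" for j
      using LIMSEQ_le_const[OF tendsto_diff[OF a[of "j + 1"] a[of j]], of c]
        LIMSEQ_le_const2[OF tendsto_diff[OF a[of "j + 1"] a[of j]], of C] b_inc by auto
    have Yr: "(\<lambda>k. Y (r k)) \<longlonglongrightarrow> y" using LIMSEQ_subseq_LIMSEQ[OF Y(2) r(1)] by (simp add: o_def)
    have knots: "dist (phi (of_int j * T) x) (phi (a j) y) \<le> \<delta>" for j
    proof (rule LIMSEQ_le_const2)
      show "(\<lambda>k. dist (phi (of_int j * T) x) (phi (b (r k) j) (Y (r k))))
        \<longlonglongrightarrow> dist (phi (of_int j * T) x) (phi (a j) y)"
        by (intro tendsto_intros a Yr)
      show "\<exists>N. \<forall>k\<ge>N. dist (phi (of_int j * T) x) (phi (b (r k) j) (Y (r k))) \<le> \<delta>"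
        using h(2) by (auto simp: b_def)
    qed
    obtain g where g: "g \<in> Rep" "\<And>t. a \<lfloor>t / T\<rfloor> \<le> g t" "\<And>t. g t \<le> a (\<lfloor>t / T\<rfloor> + 1)"
      using Rep_interpolation[of T c a] pos a0 a_inc by blast
    have "dist (phi t x) (phi (g t) y) \<le> \<eta>" for t
    proof -
      \<comment> \<open>After the knot \<open>j\<close>, the orbit of \<open>x\<close> runs for time
        at most \<open>T\<close>, and that of \<open>y\<close> for at most \<open>C\<close> because
        \<open>g t\<close> lies between \<open>a j\<close> and \<open>a (j + 1)\<close>.\<close>
      define j where "j = \<lfloor>t / T\<rfloor>"
      have "of_int j \<le> t / T" "t / T \<le> of_int j + 1" unfolding j_def by linarith+
      then have "0 \<le> t - of_int j * T" "t - of_int j * T \<le> T" using pos by (auto simp: field_simps)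
      from T[rule_format, OF this, of "phi (of_int j * T) x"] have "dist (phi t x) (phi (of_int j * T) x) \<le> \<eta> / 3" by simp
      moreover have "0 \<le> g t - a j" "g t - a j \<le> C" using g(2,3)[of t] a_inc[of j] by (auto simp: j_def)
      from C[rule_format, OF this, of "phi (a j) y"] have "dist (phi (g t) y) (phi (a j) y) \<le> \<eta> / 3" by simp
      ultimately show ?thesis using knots[of j] pos(4) by metric
    qed
    then show ?thesis using g(1) unfolding shadows_def by blast
  qed
  then show ?thesis using that pos(3) by blast
qed

section \<open>Points shadowing the orbit of \<open>x1\<close>\<close>

lemma mem_orb: "y \<in> orb phi x \<longleftrightarrow> (\<exists>t. y = phi t x)"
  by (auto simp: orb_def)

lemma flow_mem_orb_iff: "phi t y \<in> orb phi x \<longleftrightarrow> y \<in> orb phi x"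
proof
  assume "phi t y \<in> orb phi x"
  then obtain s where "phi t y = phi s x" by (auto simp: mem_orb)
  from arg_cong[OF this, of "phi (-t)"] have "y = phi (s - t) x" by simp
  then show "y \<in> orb phi x" by (auto simp: mem_orb)
qed (auto simp: mem_orb)

lemma shadows_dist: "shadows phi \<delta> x y \<Longrightarrow> dist x y \<le> \<delta>"
proof -
  assume "shadows phi \<delta> x y"
  then obtain h where "h \<in> Rep" "\<And>t. dist (phi t x) (phi (h t) y) \<le> \<delta>"
    by (auto simp: shadows_def)
  from this(2)[of 0] this(1) show ?thesis by (simp add: Rep_iff)
qed

text \<open>Two points off the orbit that shadow \<open>x1\<close> shadow each other, so they lie on a common
  short arc. If such points accumulated at \<open>x1\<close>, then \<open>x1\<close> would lie on this arc too.\<close>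

lemma shadows_orbit_imp_mem_orbit:
  assumes "expansive_on phi (UNIV - orb phi x1)"
  obtains \<delta> where "\<delta> > 0" "\<And>x y. x \<in> orb phi x1 \<Longrightarrow> shadows phi \<delta> x y \<Longrightarrow> y \<in> orb phi x1"
proof -
  obtain \<delta> where \<delta>: "\<delta> > 0" and arc:
    "\<And>x y. x \<notin> orb phi x1 \<Longrightarrow> y \<notin> orb phi x1 \<Longrightarrow> shadows phi \<delta> x y \<Longrightarrow> y \<in> (\<lambda>s. phi s x) ` {-1..1}"
    using assms unfolding expansive_on_iff_shadows by (metis Diff_iff UNIV_I zero_less_one)
  have "\<exists>\<delta>>0. \<forall>y. shadows phi \<delta> x1 y \<longrightarrow> y \<in> orb phi x1"
  proof (rule ccontr)
    assume neg: "\<not> ?thesis"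
    \<comment> \<open>The bound \<open>\<delta> / 2\<close> makes any two chosen points
      \<open>\<delta>\<close>-shadow each other through \<open>x1\<close>; \<open>1 / Suc n\<close>
      forces convergence to \<open>x1\<close>.\<close>
    have "\<exists>y. shadows phi (min (\<delta> / 2) (1 / Suc n)) x1 y \<and> y \<notin> orb phi x1" for n
    proof -
      have "min (\<delta> / 2) (1 / Suc n) > 0" using \<delta> by simp
      then show ?thesis using neg by blast
    qed
    then obtain Y where Y: "\<And>n. shadows phi (min (\<delta> / 2) (1 / Suc n)) x1 (Y n)"
      "\<And>n. Y n \<notin> orb phi x1" by metis
    have "dist (Y n) x1 \<le> 1 / Suc n" for n
      using shadows_dist[OF Y(1), of n] by (simp add: dist_commute)
    then have "Y \<longlonglongrightarrow> x1"
      unfolding tendsto_dist_iff[of Y]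
      by (intro tendsto_sandwich[OF _ _ tendsto_const LIMSEQ_Suc[OF lim_1_over_n]])
        (auto intro!: always_eventually)
    moreover have "compact ((\<lambda>s. phi s (Y 0)) ` {-1..1})"
      by (intro compact_continuous_image continuous_intros) auto
    then have "closed ((\<lambda>s. phi s (Y 0)) ` {-1..1})" by (rule compact_imp_closed)
    moreover have "Y n \<in> (\<lambda>s. phi s (Y 0)) ` {-1..1}" for n
    proof (rule arc[OF Y(2) Y(2)])
      have "shadows phi (\<delta> / 2) x1 (Y m)" for m
        using Y(1)[of m] by (rule shadows_mono) simp
      from shadows_trans[OF shadows_sym[OF this] this] show "shadows phi \<delta> (Y 0) (Y n)" by simp
    qed
    ultimately have "x1 \<in> (\<lambda>s. phi s (Y 0)) ` {-1..1}"
      by (metis closed_sequentially)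
    then obtain s where "x1 = phi s (Y 0)" by blast
    moreover have "x1 \<in> orb phi x1" unfolding mem_orb by (rule exI[of _ 0]) simp
    ultimately show False using Y(2)[of 0] flow_mem_orb_iff by metis
  qed
  then obtain d where d: "d > 0" "\<And>y. shadows phi d x1 y \<Longrightarrow> y \<in> orb phi x1" by blast
  \<comment> \<open>Recentring at time \<open>-r\<close> carries \<open>x = phi r x1\<close> back to
    \<open>x1\<close> and moves \<open>y\<close> only within its own orbit.\<close>
  have "y \<in> orb phi x1" if xy: "x \<in> orb phi x1" "shadows phi d x y" for x y
  proof -
    from xy(2) obtain h where h: "h \<in> Rep" "\<And>t. dist (phi t x) (phi (h t) y) \<le> d"
      by (auto simp: shadows_def)
    from xy(1) obtain r where "x = phi r x1" by (auto simp: mem_orb)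
    with shadows_flow[OF h, of "-r"] have "shadows phi d x1 (phi (h (-r)) y)" by simp
    then show ?thesis using d(2) flow_mem_orb_iff by blast
  qed
  then show ?thesis using that d(1) by blast
qed

section \<open>Pairs on a periodic orbit\<close>

text \<open>Shadowing enters only through closeness at time 0. Times of bad pairs reduce to the
  compact interval \<open>{0..T}\<close>; in the limit the two points coincide, so the times differ
  by one that fixes \<open>x1\<close>.\<close>

lemma expansive_on_periodic_orbit:
  assumes period: "T > 0" "phi T x1 = x1" and "\<epsilon> > 0"
  shows "\<exists>\<delta>>0. \<forall>x\<in>orb phi x1. \<forall>y\<in>orb phi x1. shadows phi \<delta> x y \<longrightarrow> y \<in> (\<lambda>s. phi s x) ` {-\<epsilon>..\<epsilon>}"
proof (rule ccontr)
  assume neg: "\<not> ?thesis"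
  have "\<exists>p. p \<in> {0..T} \<times> {0..T} \<and> dist (phi (fst p) x1) (phi (snd p) x1) \<le> 1 / Suc n \<and>
    phi (snd p) x1 \<notin> (\<lambda>s. phi s (phi (fst p) x1)) ` {-\<epsilon>..\<epsilon>}" for n
  proof -
    have "(0::real) < 1 / Suc n" by simp
    then obtain x y where xy: "x \<in> orb phi x1" "y \<in> orb phi x1" "shadows phi (1 / Suc n) x y"
      "y \<notin> (\<lambda>s. phi s x) ` {-\<epsilon>..\<epsilon>}" using neg by blast
    obtain r u where "x = phi r x1" "y = phi u x1" using xy by (auto simp: mem_orb)
    moreover obtain r' where "r' \<in> {0..T}" "phi r' x1 = phi r x1"
      using reduce_mod_period[OF period, of r] by auto
    moreover obtain u' where "u' \<in> {0..T}" "phi u' x1 = phi u x1"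
      using reduce_mod_period[OF period, of u] by auto
    ultimately show ?thesis using xy shadows_dist[OF xy(3)]
      by (intro exI[of _ "(r', u')"]) (simp del: flow_flow)
  qed
  then obtain p where p: "\<And>n. p n \<in> {0..T} \<times> {0..T}"
    "\<And>n. dist (phi (fst (p n)) x1) (phi (snd (p n)) x1) \<le> 1 / Suc n"
    "\<And>n. phi (snd (p n)) x1 \<notin> (\<lambda>s. phi s (phi (fst (p n)) x1)) ` {-\<epsilon>..\<epsilon>}" by metis
  have "seq_compact ({0..T} \<times> {0..T})"
    by (intro compact_imp_seq_compact compact_Times) auto
  then obtain l k where k: "strict_mono (k :: nat \<Rightarrow> nat)" "(p \<circ> k) \<longlonglongrightarrow> l"
    using p(1) unfolding seq_compact_def by blast
  define f where "f n = fst (p (k n))" for n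
  define g where "g n = snd (p (k n))" for n
  have f: "f \<longlonglongrightarrow> fst l" and g: "g \<longlonglongrightarrow> snd l"
    using tendsto_fst[OF k(2)] tendsto_snd[OF k(2)] unfolding f_def g_def o_def by auto
  have "(\<lambda>n. dist (phi (fst (p n)) x1) (phi (snd (p n)) x1)) \<longlonglongrightarrow> 0"
    by (rule tendsto_sandwich[OF _ _ tendsto_const LIMSEQ_Suc[OF lim_1_over_n]])
      (use p(2) in \<open>auto intro!: always_eventually\<close>)
  from LIMSEQ_subseq_LIMSEQ[OF this k(1)]
  have "(\<lambda>n. dist (phi (f n) x1) (phi (g n) x1)) \<longlonglongrightarrow> 0" by (simp add: o_def f_def g_def)
  moreover have "(\<lambda>n. dist (phi (f n) x1) (phi (g n) x1)) \<longlonglongrightarrow> dist (phi (fst l) x1) (phi (snd l) x1)"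
    by (intro tendsto_intros f g)
  ultimately have "phi (fst l) x1 = phi (snd l) x1" using LIMSEQ_unique by fastforce
  from arg_cong[OF this, of "phi (- snd l)"] have per: "phi (fst l - snd l) x1 = x1" by simp
  \<comment> \<open>The time difference, corrected by \<open>fst l - snd l\<close>, which fixes
    \<open>x1\<close>: it tends to 0 and still carries the first point to the second.\<close>
  define w where "w n = g n - f n + (fst l - snd l)" for n
  have "w \<longlonglongrightarrow> snd l - fst l + (fst l - snd l)" unfolding w_def by (intro tendsto_intros f g)
  then have "w \<longlonglongrightarrow> 0" by simp
  then obtain n where n: "\<bar>w n\<bar> < \<epsilon>"
    using \<open>\<epsilon> > 0\<close> unfolding LIMSEQ_def dist_real_def by force
  have "phi (g n) (phi (fst l - snd l) x1) = phi (w n) (phi (f n) x1)"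
    by (simp add: w_def algebra_simps)
  then have "phi (g n) x1 = phi (w n) (phi (f n) x1)" by (simp only: per)
  moreover have "w n \<in> {-\<epsilon>..\<epsilon>}" using n by auto
  ultimately show False using p(3)[of "k n"] unfolding f_def g_def by blast
qed

section \<open>Pairs on an aperiodic orbit\<close>

text \<open>A bad pair gives a time change \<open>H\<close> along the orbit of \<open>x1\<close>
  whose lag \<open>\<bar>H t - t\<bar>\<close> exceeds \<open>e\<close> at one time. The lag can
  never equal \<open>e\<close>, so it exceeds \<open>e\<close> everywhere, in particular at
  \<open>s\<close>; injectivity then pushes \<open>H s\<close> out of
  \<open>{-N..N}\<close>.\<close>

lemma unbounded_shadowing_times:
  assumes inj: "inj (\<lambda>t. phi t x1)" and "\<epsilon> > 0" "\<eta> > 0"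
    and far: "\<And>\<delta>. \<delta> > 0 \<Longrightarrow> \<exists>x\<in>orb phi x1. \<exists>y\<in>orb phi x1. shadows phi \<delta> x y \<and> y \<notin> (\<lambda>s. phi s x) ` {-\<epsilon>..\<epsilon>}"
  obtains v where "\<bar>v\<bar> > N" "shadows phi \<eta> (phi s x1) (phi v x1)"
proof -
  obtain T0 where T0: "T0 > 0" "\<And>s. s \<noteq> 0 \<Longrightarrow> \<bar>s\<bar> \<le> T0 \<Longrightarrow> \<exists>\<gamma>>0. \<forall>z. \<gamma> \<le> dist (phi s z) z"
    using short_times_move by blast
  define e where "e = min \<epsilon> T0"
  have e: "0 < e" "e \<le> \<epsilon>" "e \<le> T0" using assms T0 by (auto simp: e_def)
  obtain \<gamma> where \<gamma>: "\<gamma> > 0" "\<And>z. \<gamma> \<le> dist (phi e z) z" using T0(2)[of e] e by auto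
  obtain \<gamma>' where \<gamma>': "\<gamma>' > 0" "\<And>z. \<gamma>' \<le> dist (phi (-e) z) z" using T0(2)[of "-e"] e by auto
  define K where "K = {-N..N} \<inter> {v. e \<le> \<bar>v - s\<bar>}"
  \<comment> \<open>\<open>K\<close> holds the values to be ruled out for \<open>H s\<close>.
    Injectivity and compactness keep their points away from \<open>phi s x1\<close>; for empty
    \<open>K\<close> the value 1 serves.\<close>
  have "\<exists>\<mu>>0. \<forall>v\<in>K. \<mu> \<le> dist (phi s x1) (phi v x1)"
  proof (cases "K = {}")
    case False
    have cont: "continuous_on K (\<lambda>v. dist (phi s x1) (phi v x1))" by (intro continuous_intros)
    have "compact K" unfolding K_def
      by (intro compact_Int_closed closed_Collect_le continuous_intros) auto
    then obtain v where v: "v \<in> K" "\<And>w. w \<in> K \<Longrightarrow> dist (phi s x1) (phi v x1) \<le> dist (phi s x1) (phi w x1)"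
      using continuous_attains_inf[OF _ False, of "\<lambda>v. dist (phi s x1) (phi v x1)"] cont by blast
    have "v \<noteq> s" using v(1) e by (auto simp: K_def)
    then have "phi s x1 \<noteq> phi v x1" using inj by (auto simp: inj_def)
    with v(2) show ?thesis by (intro exI[of _ "dist (phi s x1) (phi v x1)"]) auto
  qed (auto intro: exI[of _ 1])
  then obtain \<mu> where \<mu>: "\<mu> > 0" "\<And>v. v \<in> K \<Longrightarrow> \<mu> \<le> dist (phi s x1) (phi v x1)" by blast
  define \<delta> where "\<delta> = min \<eta> (min (\<gamma> / 2) (min (\<gamma>' / 2) (\<mu> / 2)))"
  have \<delta>: "\<delta> > 0" "\<delta> \<le> \<eta>" "\<delta> < \<gamma>" "\<delta> < \<gamma>'" "\<delta> < \<mu>"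
    using \<gamma> \<gamma>' \<mu> \<open>\<eta> > 0\<close> by (auto simp: \<delta>_def)
  obtain x y where xy: "x \<in> orb phi x1" "y \<in> orb phi x1" "shadows phi \<delta> x y"
    "y \<notin> (\<lambda>s. phi s x) ` {-\<epsilon>..\<epsilon>}"
    using far[OF \<delta>(1)] by blast
  obtain r u where ru: "x = phi r x1" "y = phi u x1" using xy by (auto simp: mem_orb)
  obtain h where h: "h \<in> Rep" "\<And>t. dist (phi t x) (phi (h t) y) \<le> \<delta>"
    using xy(3) by (auto simp: shadows_def)
  define H where "H t = h (t - r) + u" for t
  have H: "dist (phi t x1) (phi (H t) x1) \<le> \<delta>" for t
    using h(2)[of "t - r"] by (simp add: ru H_def add.commute)
  have Hr: "H r = u" using h(1) by (simp add: H_def Rep_iff)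
  have "e < \<bar>u - r\<bar>"
  proof (rule ccontr)
    assume "\<not> e < \<bar>u - r\<bar>"
    then have "u - r \<in> {-\<epsilon>..\<epsilon>}" using e by auto
    moreover have "y = phi (u - r) x" by (simp add: ru)
    ultimately show False using xy(4) by blast
  qed
  \<comment> \<open>A lag of exactly \<open>e\<close> would displace a point by at least
    \<open>\<gamma>\<close> or \<open>\<gamma>'\<close>, both larger than
    \<open>\<delta>\<close>.\<close>
  have ne: "\<bar>H t - t\<bar> \<noteq> e" for t
  proof
    assume "\<bar>H t - t\<bar> = e"
    then consider "H t = t + e" | "H t = t - e" by linarith
    then show False
    proof cases
      case 1
      then show False using H[of t] \<gamma>(2)[of "phi t x1"] \<delta> by (simp add: dist_commute)
    next
      case 2
      then show False using H[of t] \<gamma>'(2)[of "phi t x1"] \<delta> by (simp add: dist_commute)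
    qed
  qed
  have "e < \<bar>H s - s\<bar>"
  proof (rule ccontr)
    assume "\<not> e < \<bar>H s - s\<bar>"
    have "continuous_on UNIV (\<lambda>t. \<bar>H t - t\<bar>)" unfolding H_def
      by (intro continuous_intros continuous_on_compose2[OF Rep_continuous[OF h(1), of UNIV]]) simp_all
    then have "connected (range (\<lambda>t. \<bar>H t - t\<bar>))"
      by (rule connected_continuous_image) simp
    then have "e \<in> range (\<lambda>t. \<bar>H t - t\<bar>)"
      by (rule connectedD_interval[of _ "\<bar>H s - s\<bar>" "\<bar>H r - r\<bar>"])
        (use \<open>\<not> e < \<bar>H s - s\<bar>\<close> \<open>e < \<bar>u - r\<bar>\<close> Hr in auto)
    then show False using ne by auto
  qed
  have "\<bar>H s\<bar> > N"
  proof (rule ccontr)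
    assume "\<not> ?thesis"
    then have "H s \<in> K" using \<open>e < \<bar>H s - s\<bar>\<close> by (auto simp: K_def)
    then show False using \<mu>(2)[of "H s"] H[of s] \<delta> by linarith
  qed
  moreover have "shadows phi \<delta> (phi s x1) (phi (H s) x1)"
    using shadows_flow[OF h, of "s - r"] by (simp add: ru H_def add.commute)
  then have "shadows phi \<eta> (phi s x1) (phi (H s) x1)" using \<delta>(2) by (rule shadows_mono)
  ultimately show ?thesis by (rule that)
qed

text \<open>The strict inequality \<open>\<delta>' < \<delta>\<close> leaves room for a further
  small shadowing error, so points at distant times supplied by \<open>escape\<close> stay in the
  class. Hence no bounded orbit arc contains a nonempty relatively open subset of the closure, and
  Baire applies.\<close>

lemma shadowing_class_not_in_aperiodic_orbit:
  assumes inj: "inj (\<lambda>t. phi t x1)" and "\<delta> > 0"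
    and escape: "\<And>N s \<eta>. \<eta> > 0 \<Longrightarrow> \<exists>v. \<bar>v\<bar> > N \<and> shadows phi \<eta> (phi s x1) (phi v x1)"
  shows "\<not> closure {y. \<exists>\<delta>'<\<delta>. shadows phi \<delta>' x1 y} \<subseteq> orb phi x1"
proof
  define D where "D = {y. \<exists>\<delta>'<\<delta>. shadows phi \<delta>' x1 y}"
  define A where "A n = closure D \<inter> (\<lambda>t. phi t x1) ` {-real n..real n}" for n
  let ?X = "top_of_set (closure D)"
  assume "closure {y. \<exists>\<delta>'<\<delta>. shadows phi \<delta>' x1 y} \<subseteq> orb phi x1"
  then have sub: "closure D \<subseteq> orb phi x1" by (simp add: D_def)
  have "shadows phi 0 x1 x1"
    unfolding shadows_def by (rule bexI[of _ id]) (auto simp: Rep_iff strict_mono_def)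
  then have "x1 \<in> closure D" using \<open>\<delta> > 0\<close> closure_subset[of D] by (auto simp: D_def)
  have comp: "compact (closure D)"
    using compact_Int_closed[OF compact_space closed_closure[of D]] by simp
  have "closed ((\<lambda>t. phi t x1) ` {-real n..real n})" for n
    by (intro compact_imp_closed compact_continuous_image continuous_intros) auto
  then have closedin: "closedin ?X (A n)" for n
    unfolding A_def by (simp add: closedin_closed_Int)
  have no_interior: "?X interior_of (A n) = {}" for n
  proof (rule ccontr)
    assume "?X interior_of (A n) \<noteq> {}"
    then obtain U where U: "openin ?X U" "U \<noteq> {}" "U \<subseteq> A n"
      by (metis interior_of_subset openin_interior_of)
    then obtain V where V: "open V" "U = closure D \<inter> V" by (auto simp: openin_open)
    \<comment> \<open>The slack below \<open>\<delta>\<close> is available only in \<open>D\<close>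
      itself, so a point of \<open>D\<close> is picked rather than one of its closure.\<close>
    then have "V \<inter> D \<noteq> {}" using U open_Int_closure_eq_empty[of V D] by auto
    then obtain y where y: "y \<in> V" "y \<in> D" by blast
    then have "y \<in> orb phi x1" using sub closure_subset[of D] by blast
    then obtain s where s: "y = phi s x1" by (auto simp: mem_orb)
    obtain \<delta>' where \<delta>': "\<delta>' < \<delta>" "shadows phi \<delta>' x1 y" using y by (auto simp: D_def)
    obtain e where e: "e > 0" "ball y e \<subseteq> V" using V y open_contains_ball by blast
    \<comment> \<open>One half keeps the new point inside the ball in \<open>V\<close>, the other
      keeps it in \<open>D\<close>.\<close>
    define \<eta> where "\<eta> = min (e / 2) ((\<delta> - \<delta>') / 2)"
    have \<eta>: "\<eta> > 0" "\<eta> < e" "\<delta>' + \<eta> < \<delta>" using e(1) \<delta>'(1) unfolding \<eta>_def by (simp_all add: min_def field_simps)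
    obtain v where v: "\<bar>v\<bar> > real n" "shadows phi \<eta> y (phi v x1)"
      using escape[OF \<eta>(1)] s by blast
    have "phi v x1 \<in> V" using shadows_dist[OF v(2)] \<eta> e by auto
    moreover have "phi v x1 \<in> D" using shadows_trans[OF \<delta>'(2) v(2)] \<eta> by (auto simp: D_def)
    ultimately have "phi v x1 \<in> A n" using V U closure_subset[of D] by blast
    then obtain w where "w \<in> {-real n..real n}" "phi v x1 = phi w x1" unfolding A_def by blast
    then show False using v(1) injD[OF inj, of v w] by auto
  qed
  have "locally_compact_space ?X" "regular_space ?X"
    using comp by (auto simp: compact_imp_locally_compact_space compact_space_subtopology
      regular_space_subtopology regular_space_euclidean)
  then have "?X interior_of \<Union>(range A) = {}"
    using closedin no_interior by (intro Baire_category_alt) auto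
  moreover have "\<Union>(range A) = topspace ?X"
  proof -
    have "y \<in> \<Union>(range A)" if "y \<in> closure D" for y
    proof -
      have "y \<in> orb phi x1" using that sub by blast
      then obtain t where t: "y = phi t x1" by (auto simp: mem_orb)
      obtain n where "\<bar>t\<bar> \<le> real n" using real_arch_simple by blast
      then have "t \<in> {-real n..real n}" by auto
      then have "y \<in> A n" using t that unfolding A_def by blast
      then show ?thesis by blast
    qed
    then show ?thesis by (auto simp: A_def)
  qed
  ultimately show False using \<open>x1 \<in> closure D\<close> interior_of_topspace[of ?X] by auto
qed

section \<open>Expansiveness on the orbit and on the whole space\<close>

lemma expansive_on_orbit:
  assumes exp: "expansive_on phi (UNIV - orb phi x1)" and "\<epsilon> > 0"
  shows "\<exists>\<delta>>0. \<forall>x\<in>orb phi x1. \<forall>y\<in>orb phi x1. shadows phi \<delta> x y \<longrightarrow> y \<in> (\<lambda>s. phi s x) ` {-\<epsilon>..\<epsilon>}"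
proof (cases "inj (\<lambda>t. phi t x1)")
  case False
  then obtain a b where ab: "a < b" "phi a x1 = phi b x1"
    by (metis injI linorder_neqE_linordered_idom)
  from arg_cong[OF this(2), of "phi (-a)"] have "phi (b - a) x1 = x1" by simp
  then show ?thesis using expansive_on_periodic_orbit[of "b - a"] ab assms by simp
next
  case True
  show ?thesis
  proof (rule ccontr)
    assume neg: "\<not> ?thesis"
    have escape: "\<exists>v. \<bar>v\<bar> > N \<and> shadows phi \<eta> (phi s x1) (phi v x1)" if "\<eta> > 0" for N s \<eta>
      by (rule unbounded_shadowing_times[OF True \<open>\<epsilon> > 0\<close> that]) (use neg in blast)+
    obtain \<eta> where \<eta>: "\<eta> > 0" "\<And>x y. x \<in> orb phi x1 \<Longrightarrow> shadows phi \<eta> x y \<Longrightarrow> y \<in> orb phi x1"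
      using shadows_orbit_imp_mem_orbit[OF exp] by blast
    \<comment> \<open>Limits of \<open>\<delta>\<close>-shadowing points still
      \<open>\<eta>\<close>-shadow \<open>x1\<close>, and \<open>\<eta>\<close> was chosen to force
      such points onto the orbit.\<close>
    obtain \<delta> where \<delta>: "\<delta> > 0"
      "\<And>x y Y. (\<And>k::nat. shadows phi \<delta> x (Y k)) \<Longrightarrow> Y \<longlonglongrightarrow> y \<Longrightarrow> shadows phi \<eta> x y"
      using shadows_limit[OF \<eta>(1)] by blast
    have x1: "x1 \<in> orb phi x1" unfolding mem_orb by (rule exI[of _ 0]) simp
    have "closure {y. \<exists>\<delta>'<\<delta>. shadows phi \<delta>' x1 y} \<subseteq> orb phi x1"
    proof
      fix y
      assume "y \<in> closure {y. \<exists>\<delta>'<\<delta>. shadows phi \<delta>' x1 y}"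
      then obtain Y where Y: "\<And>k. \<exists>\<delta>'<\<delta>. shadows phi \<delta>' x1 (Y k)" "Y \<longlonglongrightarrow> y"
        unfolding closure_sequential by blast
      have "shadows phi \<delta> x1 (Y k)" for k using Y(1)[of k] shadows_mono less_imp_le by blast
      from \<delta>(2)[OF this Y(2)] show "y \<in> orb phi x1" by (rule \<eta>(2)[OF x1])
    qed
    then show False using shadowing_class_not_in_aperiodic_orbit[OF True \<delta>(1) escape] by blast
  qed
qed

text \<open>Below \<open>\<eta>\<close>, no shadowing pair has just one point on the orbit, by
  symmetry of shadowing; the two unmixed cases each come with their own constant.\<close>

lemma expansive_on_UNIV:
  assumes exp: "expansive_on phi (UNIV - orb phi x1)"
  shows "expansive_on phi UNIV"
  unfolding expansive_on_iff_shadows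
proof (intro allI impI)
  fix \<epsilon> :: real
  assume "\<epsilon> > 0"
  obtain \<eta> where \<eta>: "\<eta> > 0" "\<And>x y. x \<in> orb phi x1 \<Longrightarrow> shadows phi \<eta> x y \<Longrightarrow> y \<in> orb phi x1"
    using shadows_orbit_imp_mem_orbit[OF exp] by blast
  obtain \<delta>1 where \<delta>1: "\<delta>1 > 0"
    "\<forall>x\<in>orb phi x1. \<forall>y\<in>orb phi x1. shadows phi \<delta>1 x y \<longrightarrow> y \<in> (\<lambda>s. phi s x) ` {-\<epsilon>..\<epsilon>}"
    using expansive_on_orbit[OF exp \<open>\<epsilon> > 0\<close>] by blast
  obtain \<delta>2 where \<delta>2: "\<delta>2 > 0"
    "\<forall>x\<in>UNIV - orb phi x1. \<forall>y\<in>UNIV - orb phi x1. shadows phi \<delta>2 x y \<longrightarrow> y \<in> (\<lambda>s. phi s x) ` {-\<epsilon>..\<epsilon>}"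
    using exp \<open>\<epsilon> > 0\<close> unfolding expansive_on_iff_shadows by blast
  have "y \<in> (\<lambda>s. phi s x) ` {-\<epsilon>..\<epsilon>}" if "shadows phi (min \<eta> (min \<delta>1 \<delta>2)) x y" for x y
  proof -
    have sh: "shadows phi \<eta> x y" "shadows phi \<delta>1 x y" "shadows phi \<delta>2 x y"
      using that by (auto elim: shadows_mono)
    have "x \<in> orb phi x1 \<longleftrightarrow> y \<in> orb phi x1"
      using \<eta>(2) sh(1) shadows_sym[OF sh(1)] by blast
    then show ?thesis using \<delta>1(2) \<delta>2(2) sh by (cases "x \<in> orb phi x1") auto
  qed
  then show "\<exists>\<delta>>0. \<forall>x\<in>UNIV. \<forall>y\<in>UNIV. shadows phi \<delta> x y \<longrightarrow> y \<in> (\<lambda>s. phi s x) ` {-\<epsilon>..\<epsilon>}"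
    using \<eta>(1) \<delta>1(1) \<delta>2(1) by (intro exI[of _ "min \<eta> (min \<delta>1 \<delta>2)"]) simp
qed

end

theorem theoremC:
  fixes phi :: "real \<Rightarrow> 'a::metric_space \<Rightarrow> 'a" and x1 :: 'a
  assumes "compact (UNIV :: 'a set)"
    and "regular_flow phi"
    and "expansive_on phi (UNIV - orb phi x1)"
  shows "expansive_on phi UNIV"
proof -
  interpret compact_regular_flow phi
    using assms by unfold_locales
  show ?thesis using assms(3) by (rule expansive_on_UNIV)
qed

end
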